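(* Let $k\geq 1$ and $m\geq 1$ be integers, and let $A=\{a_s(n_s)\}_{s=1}^k$ be a finite system of residue classes (with $a_s\in\mathbb{Z}$, $n_s\in\mathbb{Z}_{>0}$) such that $A$ is an $m$-cover of the integers with the residue class $a_k(n_k)$ irredundant. Suppose that the covering function $w_A$ is periodic modulo $n_k$, i.e. $w_A(x+n_k)=w_A(x)$ for all $x\in\mathbb{Z}$. Then for every $r\in\{0,1,\ldots,n_k-1\}$, $$\bigg|\bigg\{\bigg\lfloor\sum_{s\in I}\frac1{n_s}\bigg\rfloor:\ I\subseteq\{1,\ldots,k-1\}\ \text{and}\ \bigg\{\sum_{s\in I}\frac1{n_s}\bigg\}=\frac r{n_k}\bigg\}\bigg|\geq m,$$ where $\lfloor\alpha\rfloor$ and $\{\alpha\}$ denote the integral part and the fractional part of a real number $\alpha$.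
   Context: For integers $a$ and $n>0$, $a(n)$ denotes the residue class $\{x\in\mathbb{Z}: x\equiv a \pmod n\}$. For a system $A=\{a_s(n_s)\}_{s=1}^k$, the covering function is $w_A(x)=|\{1\leq s\leq k: x\in a_s(n_s)\}|$ for $x\in\mathbb{Z}$. $A$ is an $m$-cover of the integers if $w_A(x)\geq m$ for all $x\in\mathbb{Z}$. $A$ forms an $m$-cover of the integers with $a_t(n_t)$ irredundant if $A$ is an $m$-cover of the integers but the system $\{a_s(n_s)\}_{s\in\{1,\ldots,k\}\setminus\{t\}}$ is not. An empty sum equals $0$. *)

theory Defs
  imports Complex_Main
begin

definition residue_class :: "int \<Rightarrow> nat \<Rightarrow> int set" where
  "residue_class a n = {x. x mod int n = a mod int n}"

text \<open>A system of residue classes is a family \<open>a s (n s)\<close> indexed by a finite set \<open>S\<close>, so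
  repeated classes are counted with multiplicity; dropping a class means removing its index.\<close>

definition covering_function :: "nat set \<Rightarrow> (nat \<Rightarrow> int) \<Rightarrow> (nat \<Rightarrow> nat) \<Rightarrow> int \<Rightarrow> nat" where
  "covering_function S a n x = card {s \<in> S. x \<in> residue_class (a s) (n s)}"

definition is_m_cover :: "nat \<Rightarrow> nat set \<Rightarrow> (nat \<Rightarrow> int) \<Rightarrow> (nat \<Rightarrow> nat) \<Rightarrow> bool" where
  "is_m_cover m S a n \<longleftrightarrow> (\<forall>x. covering_function S a n x \<ge> m)"

definition is_m_cover_irredundant ::
    "nat \<Rightarrow> nat set \<Rightarrow> (nat \<Rightarrow> int) \<Rightarrow> (nat \<Rightarrow> nat) \<Rightarrow> nat \<Rightarrow> bool" where
  "is_m_cover_irredundant m S a n t \<longleftrightarrow>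
     is_m_cover m S a n \<and> \<not> is_m_cover m (S - {t}) a n"

end

theory Submission
  imports Defs "HOL-Computational_Algebra.Polynomial" "HOL-Library.Real_Mod"
begin

text \<open>Let \<open>N\<close> be a common multiple of the moduli, \<open>\<zeta> = exp (2 \<pi> \<i> / N)\<close>, and let
  \<open>P(z)\<close> be the product of \<open>1 - exp (- 2 \<pi> \<i> a\<^sub>s / n\<^sub>s) z^(N / n\<^sub>s)\<close> over \<open>s < k\<close>. An exponent
  occurring in \<open>P\<close> is a sum of the \<open>N / n\<^sub>s\<close> over some \<open>I \<subseteq> {1..k - 1}\<close>, while
  \<open>P(z) = \<Prod>\<^sub>x (1 - \<zeta>^(- x) z)^w'(x)\<close>, where \<open>x\<close> runs over the residues modulo \<open>N\<close> and \<open>w'\<close> is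
  the covering function of the first \<open>k - 1\<close> classes. Periodicity and irredundance force
  \<open>w' = m - 1\<close> on the class \<open>a\<^sub>k(n\<^sub>k)\<close> and \<open>w' \<ge> m\<close> off it, so \<open>P = (1 - z^N)^(m - 1) T\<close>, where
  \<open>y \<mapsto> T(\<zeta>^y)\<close> is periodic modulo \<open>n\<^sub>k\<close> and nonzero exactly on that class. For
  \<open>j = r N / n\<^sub>k\<close>, collecting the exponents \<open>j + N q\<close> of \<open>P\<close> gives the polynomial
  \<open>(1 - u)^(m - 1) T\<^sub>j(u)\<close> in \<open>u = z^N\<close>; by the root-of-unity filter \<open>T\<^sub>j(1)\<close> is a nonzero multiple
  of the common value of \<open>T\<close> on the class. A nonzero multiple of \<open>(1 - u)^(m - 1)\<close> has at least
  \<open>m\<close> nonzero coefficients, and each such \<open>q\<close> is one of the integral parts to be counted.\<close>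

section \<open>Nonzero coefficients of multiples of powers of \<open>1 - X\<close>\<close>

lemma coeff_one_minus_X_power_mult:
  fixes p :: "'a :: comm_ring_1 poly"
  shows "coeff ((1 - monom 1 N) * p) i = coeff p i - (if i < N then 0 else coeff p (i - N))"
  by (simp add: left_diff_distrib coeff_monom_mult)

text \<open>By induction on \<open>d\<close>: a differential operator gives up one factor
  \<open>1 - X\<close> in exchange for removing one nonzero coefficient, and a nonzero polynomial
  still has a coefficient left at the end.\<close>

lemma Suc_le_card_coeffs_if_dvd:
  fixes p :: "'a :: {idom, semiring_char_0} poly"
  assumes "p \<noteq> 0" and "(1 - monom 1 1) ^ d dvd p"
  shows "Suc d \<le> card {i. coeff p i \<noteq> 0}"
  using assms
proof (induction d arbitrary: p)
  case (0 p)
  have "finite {i. coeff p i \<noteq> 0}"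
    using MOST_coeff_eq_0[of p] by (simp add: MOST_iff_cofinite)
  moreover have "degree p \<in> {i. coeff p i \<noteq> 0}"
    using 0 by simp
  ultimately show ?case
    by (metis card_gt_0_iff empty_iff Suc_le_eq)
next
  case (Suc d p)
  have fin: "finite {i. coeff p i \<noteq> 0}"
    using MOST_coeff_eq_0[of p] by (simp add: MOST_iff_cofinite)
  define j where "j = degree p"
  have j: "coeff p j \<noteq> 0"
    using Suc.prems by (simp add: j_def)
  \<comment> \<open>The operator \<open>X (d/dX) - j\<close> kills exactly the monomial \<open>X^j\<close> and lowers the order of
    vanishing at 1 by at most one.\<close>
  define r where "r = pCons 0 (pderiv p) - smult (of_nat j) p"
  have cr: "coeff r i = (of_nat i - of_nat j) * coeff p i" for i
    by (cases i) (auto simp: r_def coeff_pderiv algebra_simps)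
  obtain q where q: "p = (1 - monom 1 1) ^ Suc d * q"
    using Suc.prems(2) by (auto elim: dvdE)
  \<comment> \<open>Otherwise \<open>p\<close> would be a single monomial, and such a
    \<open>p\<close> does not vanish at 1.\<close>
  have "r \<noteq> 0"
  proof
    assume "r = 0"
    then have "coeff p i = 0" if "i \<noteq> j" for i
      using cr[of i] that by auto
    then have "p = monom (coeff p j) j"
      by (intro poly_eqI) (auto simp: coeff_monom)
    then have "poly p 1 = coeff p j"
      by (metis poly_monom power_one mult.right_neutral)
    moreover have "poly p 1 = 0"
      by (simp add: q poly_monom)
    ultimately show False using j by simp
  qed
  moreover have "(1 - monom 1 1) ^ d dvd r"
  proof -
    have "(1 - monom 1 1) ^ d dvd pderiv p"
      unfolding q pderiv_mult pderiv_power_Suc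
      by (intro dvd_add dvd_mult2 dvd_smult dvd_mult dvd_refl) simp
    then have "(1 - monom 1 1) ^ d dvd monom 1 1 * pderiv p"
      by (rule dvd_mult)
    moreover have "monom 1 1 * pderiv p = pCons 0 (pderiv p)"
      by (simp add: monom_altdef)
    moreover have "(1 - monom 1 1) ^ d dvd smult (of_nat j) p"
      unfolding q by (intro dvd_smult) simp
    ultimately show ?thesis unfolding r_def by (metis dvd_diff)
  qed
  ultimately have "Suc d \<le> card {i. coeff r i \<noteq> 0}"
    by (rule Suc.IH)
  also have "{i. coeff r i \<noteq> 0} = {i. coeff p i \<noteq> 0} - {j}"
    by (auto simp: cr)
  finally show ?case
    using fin j by (simp add: card_Diff_singleton)
qed

section \<open>Sections of a polynomial along an arithmetic progression of exponents\<close>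

definition poly_section :: "nat \<Rightarrow> nat \<Rightarrow> 'a :: comm_ring_1 poly \<Rightarrow> 'a poly" where
  "poly_section N j p = (\<Sum>q\<le>degree p. monom (coeff p (j + N * q)) q)"

text \<open>Cutting off at \<open>degree p\<close> loses nothing, because \<open>N > 0\<close> gives
  \<open>q <= N * q\<close>.\<close>

lemma coeff_poly_section:
  assumes "N > 0"
  shows "coeff (poly_section N j p) q = coeff p (j + N * q)"
proof -
  have "coeff p (j + N * q) = 0" if "q > degree p"
  proof (rule coeff_eq_0)
    have "1 * q \<le> N * q" using assms by (intro mult_right_mono) auto
    then show "degree p < j + N * q" using that by linarith
  qed
  then show ?thesis
    by (simp add: poly_section_def coeff_sum coeff_monom not_le)
qed

text \<open>Multiplication by \<open>X^N\<close> preserves exponents modulo \<open>N\<close> and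
  raises \<open>q\<close> by one. For \<open>q = 0\<close> the bound \<open>j < N\<close> ensures
  that nothing is subtracted.\<close>

lemma poly_section_one_minus_X_power_mult:
  assumes "j < N"
  shows "poly_section N j ((1 - monom 1 N) ^ d * p) = (1 - monom 1 1) ^ d * poly_section N j p"
proof (induction d)
  case (Suc d)
  have "poly_section N j ((1 - monom 1 N) * r) = (1 - monom 1 1) * poly_section N j r" for r :: "'a poly"
  proof (rule poly_eqI)
    fix q
    show "coeff (poly_section N j ((1 - monom 1 N) * r)) q
        = coeff ((1 - monom 1 1) * poly_section N j r) q"
      using assms
      by (cases q) (simp_all add: coeff_poly_section coeff_one_minus_X_power_mult)
  qed
  then show ?case
    using Suc by (simp add: mult.assoc)
qed simp

section \<open>Roots of unity and the root-of-unity filter\<close>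

definition unity_root :: "nat \<Rightarrow> int \<Rightarrow> complex" where
  "unity_root N x = cis (2 * pi * of_int x / of_nat N)"

lemma unity_root_0 [simp]: "unity_root N 0 = 1"
  by (simp add: unity_root_def)

lemma unity_root_nonzero [simp]: "unity_root N x \<noteq> 0"
  by (simp add: unity_root_def)

lemma unity_root_mult: "unity_root N x * unity_root N y = unity_root N (x + y)"
  by (simp add: unity_root_def cis_mult add_divide_distrib algebra_simps)

lemma unity_root_power: "unity_root N x ^ i = unity_root N (x * int i)"
  by (simp add: unity_root_def DeMoivre algebra_simps)

lemma unity_root_scale: "d > 0 \<Longrightarrow> unity_root (n * d) (x * int d) = unity_root n x"
  by (simp add: unity_root_def mult.assoc[symmetric])

lemma unity_root_eq_1_iff:
  assumes "N > 0"
  shows "unity_root N x = 1 \<longleftrightarrow> int N dvd x"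
proof -
  have "2 * pi * of_int x / of_nat N = of_int y * (2 * pi) \<longleftrightarrow> x = int N * y" for y
  proof -
    have "2 * pi * of_int x / of_nat N = of_int y * (2 * pi) \<longleftrightarrow> (of_int x :: real) = of_int (int N * y)"
      using assms by (auto simp: field_simps)
    then show ?thesis by (simp only: of_int_eq_iff)
  qed
  then show ?thesis
    by (simp add: unity_root_def cis_eq_1_iff dvd_def)
qed

lemma unity_root_cong:
  assumes "N > 0" and "int N dvd x - y"
  shows "unity_root N x = unity_root N y"
proof -
  have "unity_root N x = unity_root N y * unity_root N (x - y)"
    by (simp add: unity_root_mult)
  then show ?thesis using unity_root_eq_1_iff assms by simp
qed

lemma unity_root_eq_iff:
  assumes "N > 0"
  shows "unity_root N x = unity_root N y \<longleftrightarrow> int N dvd x - y"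
proof
  assume "unity_root N x = unity_root N y"
  then have "unity_root N (x - y) = unity_root N (y - y)"
    using unity_root_mult[of N x "- y"] unity_root_mult[of N y "- y"] by simp
  then show "int N dvd x - y"
    using unity_root_eq_1_iff[OF assms] by simp
qed (use assms unity_root_cong in blast)

lemma inj_on_unity_root: "inj_on (unity_root N) {0..<int N}"
proof (cases "N > 0")
  case True
  show ?thesis
  proof (rule inj_onI)
    fix x y assume "x \<in> {0..<int N}" "y \<in> {0..<int N}" "unity_root N x = unity_root N y"
    then show "x = y"
      using unity_root_eq_iff[OF True, of x y]
      by (metis atLeastLessThan_iff mod_eq_dvd_iff mod_pos_pos_trivial)
  qed
qed simp

lemma bij_betw_shift_mod:
  assumes "N > 0"
  shows "bij_betw (\<lambda>x. (x + c) mod int N) {0..<int N} {0..<int N}"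
  by (rule bij_betw_byWitness[where f' = "\<lambda>x. (x - c) mod int N"])
     (use assms in \<open>auto simp: mod_simps\<close>)

text \<open>Shifting the summation index multiplies the sum by \<open>unity_root N i\<close>, so the
  sum vanishes unless this factor is 1.\<close>

lemma sum_unity_root:
  assumes "N > 0"
  shows "(\<Sum>y\<in>{0..<int N}. unity_root N (y * i)) = (if int N dvd i then of_nat N else 0)"
proof (cases "int N dvd i")
  case True
  then have "unity_root N (y * i) = 1" for y
    using unity_root_eq_1_iff[OF assms] by simp
  then show ?thesis using True by simp
next
  case False
  define S where "S = (\<Sum>y\<in>{0..<int N}. unity_root N (y * i))"
  have "S = (\<Sum>y\<in>{0..<int N}. unity_root N ((y + 1) mod int N * i))"
    unfolding S_def by (rule sum.reindex_bij_betw[OF bij_betw_shift_mod[OF assms], symmetric])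
  also have "\<dots> = (\<Sum>y\<in>{0..<int N}. unity_root N ((y + 1) * i))"
    by (intro sum.cong refl unity_root_cong assms)
       (simp add: mod_eq_dvd_iff[symmetric] mod_simps)
  also have "\<dots> = S * unity_root N i"
    by (simp add: S_def sum_distrib_right unity_root_mult distrib_right)
  finally have "S = 0"
    using unity_root_eq_1_iff[OF assms] False by simp
  then show ?thesis using False S_def by simp
qed

text \<open>Root-of-unity filter: by orthogonality only the exponents congruent to \<open>j\<close>
  modulo \<open>N\<close> survive, and \<open>j < N\<close> makes each of them
  \<open>j + N * q\<close> with \<open>q\<close> natural.\<close>

lemma poly_section_1_eq_sum:
  fixes p :: "complex poly"
  assumes "j < N"
  shows "of_nat N * poly (poly_section N j p) 1
    = (\<Sum>y\<in>{0..<int N}. unity_root N (- (y * int j)) * poly p (unity_root N y))"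
proof -
  have N: "N > 0" using assms by simp
  have "(\<Sum>y\<in>{0..<int N}. unity_root N (- (y * int j)) * poly p (unity_root N y))
      = (\<Sum>y\<in>{0..<int N}. \<Sum>i\<le>degree p. coeff p i * unity_root N (y * (int i - int j)))"
    by (simp add: poly_altdef sum_distrib_left unity_root_power unity_root_mult algebra_simps
        mult.left_commute[of "unity_root N _" "coeff p _"])
  also have "\<dots> = (\<Sum>i\<le>degree p. coeff p i * (\<Sum>y\<in>{0..<int N}. unity_root N (y * (int i - int j))))"
    by (subst sum.swap) (simp add: sum_distrib_left)
  also have "\<dots> = (\<Sum>i\<le>degree p. if int N dvd int i - int j then of_nat N * coeff p i else 0)"
    by (intro sum.cong) (auto simp: sum_unity_root[OF N])
  also have "\<dots> = (\<Sum>i\<in>{i. i \<le> degree p \<and> int N dvd int i - int j}. of_nat N * coeff p i)"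
    by (simp add: sum.inter_filter[symmetric])
  also have "\<dots> = (\<Sum>q\<le>degree p. of_nat N * coeff p (j + N * q))"
  proof -
    have 1: "j + N * (i div N) = i" if "int N dvd int i - int j" for i
    proof -
      have "int i mod int N = int j mod int N"
        using that by (simp add: mod_eq_dvd_iff)
      then have "i mod N = j"
        using assms by (simp add: zmod_int[symmetric])
      then show ?thesis
        by (metis mod_mult_div_eq)
    qed
    have 2: "i div N \<le> degree p" if "i \<le> degree p" for i
      using that by (intro order.trans[OF div_le_dividend])
    \<comment> \<open>The set \<open>T'\<close> holds the \<open>q\<close> whose exponent exceeds
      the degree; their terms are zero.\<close>
    show ?thesis
      by (rule sum.reindex_bij_witness_not_neutral[where S' = "{}"
          and T' = "{q. q \<le> degree p \<and> degree p < j + N * q}" and i = "\<lambda>q. j + N * q"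
          and j = "\<lambda>i. i div N"])
        (use assms 1 2 in \<open>auto simp: coeff_eq_0\<close>)
  qed
  also have "\<dots> = of_nat N * poly (poly_section N j p) 1"
    by (simp add: poly_section_def poly_sum poly_monom sum_distrib_left)
  finally show ?thesis by simp
qed

section \<open>Binomials as products over residue classes\<close>

lemma card_residues_lessThan:
  assumes "n > 0"
  shows "card {x \<in> {0..<int (n * d)}. x mod int n = a mod int n} = d"
proof -
  have "{x \<in> {0..<int (n * d)}. x mod int n = a mod int n} 
      = (\<lambda>i. a mod int n + int n * i) ` {0..<int d}" (is "?L = ?R")
  proof (intro equalityI subsetI)
    fix x assume x: "x \<in> ?L"
    then have "x = a mod int n + int n * (x div int n)"
      by (metis (mono_tags, lifting) mem_Collect_eq mod_mult_div_eq)
    moreover have "x div int n < int d"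
    proof (rule ccontr)
      assume "\<not> x div int n < int d"
      then have "int n * int d \<le> int n * (x div int n)"
        by (intro mult_left_mono) auto
      also have "\<dots> \<le> x"
        using assms mult_div_mod_eq[of "int n" x] pos_mod_sign[of "int n" x] by linarith
      finally show False using x by simp
    qed
    moreover have "x div int n \<ge> 0"
      using x assms by (simp add: pos_imp_zdiv_nonneg_iff)
    ultimately show "x \<in> ?R" by auto
  next
    fix x assume "x \<in> ?R"
    then obtain i where i: "x = a mod int n + int n * i" "i \<in> {0..<int d}"
      by (elim imageE)
    then have "0 \<le> i" "i + 1 \<le> int d" by auto
    have "x < int n * (i + 1)"
      using i assms by (simp add: algebra_simps)
    also have "\<dots> \<le> int n * int d"
      using \<open>i + 1 \<le> int d\<close> by (intro mult_left_mono) auto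
    finally show "x \<in> ?L" using i(1) \<open>0 \<le> i\<close> assms by simp
  qed
  moreover have "inj_on (\<lambda>i. a mod int n + int n * i) {0..<int d}"
    using assms by (auto intro: inj_onI)
  ultimately show ?thesis by (simp add: card_image)
qed

text \<open>Both sides have degree at most \<open>d\<close> and agree at \<open>d + 1\<close>
  points: they vanish at the \<open>d\<close> roots of unity indexed by the class, and both equal 1
  at 0.\<close>

lemma one_minus_monom_eq_prod:
  assumes "n > 0" "d > 0"
  shows "1 - monom (unity_root n (- a)) d
    = (\<Prod>x\<in>{x \<in> {0..<int (n * d)}. x mod int n = a mod int n}. 1 - monom (unity_root (n * d) (- x)) 1)"
    (is "?p = prod ?f ?B")
proof (rule poly_eqI_degree)
  define N where "N = n * d"
  have B: "?B \<subseteq> {0..<int N}" "finite ?B"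
    by (auto simp: N_def intro: finite_subset[of _ "{0..<int (n * d)}"])
  let ?A = "insert 0 (unity_root N ` ?B)"
  fix z assume "z \<in> ?A"
  then show "poly ?p z = poly (prod ?f ?B) z"
  proof
    assume "z = 0"
    then show ?thesis using assms by (simp add: poly_monom poly_prod)
  next
    assume "z \<in> unity_root N ` ?B"
    then obtain x where x: "x \<in> ?B" "z = unity_root N x" by blast
    have "unity_root n (- a) * z ^ d = unity_root n (- a + x)"
      using assms by (simp add: x(2) unity_root_power N_def unity_root_scale unity_root_mult)
    also have "\<dots> = 1"
      using x assms by (simp add: unity_root_eq_1_iff mod_eq_dvd_iff)
    finally have "poly ?p z = 0"
      by (simp add: poly_monom)
    moreover have "poly (?f x) z = 0"
      by (simp add: poly_monom x(2) unity_root_mult N_def[symmetric])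
    then have "poly (prod ?f ?B) z = 0"
      using x(1) B by (auto simp: poly_prod)
    ultimately show ?thesis by simp
  qed
next
  define N where "N = n * d"
  let ?A = "insert 0 (unity_root N ` ?B)"
  have B: "?B \<subseteq> {0..<int N}" "finite ?B"
    by (auto simp: N_def intro: finite_subset[of _ "{0..<int (n * d)}"])
  have "card ?A = Suc (card (unity_root N ` ?B))"
    using B by (subst card_insert_disjoint) auto
  also have "\<dots> = Suc d"
    using inj_on_subset[OF inj_on_unity_root B(1)] card_residues_lessThan[OF assms(1)]
    by (simp add: card_image)
  finally have A: "card ?A = Suc d" .
  have "degree ?p \<le> d"
    by (rule degree_diff_le) (simp_all add: degree_monom_le)
  then show "degree ?p < card (insert 0 (unity_root (n * d) ` ?B))"
    using A by (simp add: N_def)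
  have "degree (prod ?f ?B) \<le> (\<Sum>x\<in>?B. 1)"
  proof (rule order.trans[OF degree_prod_sum_le[OF B(2)]], rule sum_mono)
    show "(degree \<circ> ?f) x \<le> 1" for x
      unfolding o_def by (rule degree_diff_le) (simp_all add: degree_monom_le)
  qed
  also have "\<dots> = d"
    using card_residues_lessThan[OF assms(1)] by simp
  finally show "degree (prod ?f ?B) < card (insert 0 (unity_root (n * d) ` ?B))"
    using A by (simp add: N_def)
qed

text \<open>Each term of the expanded product comes from a subset of \<open>S\<close>. The converse
  can fail, since terms from different subsets may cancel.\<close>

lemma coeff_prod_one_minus_monom_nonzero:
  fixes c :: "'b \<Rightarrow> 'a :: comm_ring_1"
  assumes "finite S" and "coeff (\<Prod>s\<in>S. 1 - monom (c s) (d s)) i \<noteq> 0"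
  shows "\<exists>I\<subseteq>S. (\<Sum>s\<in>I. d s) = i"
  using assms
proof (induction S arbitrary: i rule: finite_induct)
  case empty
  then show ?case by (auto split: if_splits)
next
  case (insert t S)
  let ?P = "\<Prod>s\<in>S. 1 - monom (c s) (d s)"
  have "coeff ?P i - (if i < d t then 0 else c t * coeff ?P (i - d t)) \<noteq> 0"
    using insert.prems insert.hyps by (simp add: left_diff_distrib coeff_monom_mult)
  then consider "coeff ?P i \<noteq> 0" | "i \<ge> d t" "coeff ?P (i - d t) \<noteq> 0"
    by (cases "coeff ?P i = 0"; cases "i < d t"; cases "coeff ?P (i - d t) = 0") auto
  then show ?case
  proof cases
    case 1
    then show ?thesis using insert.IH by blast
  next
    case 2
    then obtain I where I: "I \<subseteq> S" "(\<Sum>s\<in>I. d s) = i - d t"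
      using insert.IH by blast
    have "(\<Sum>s\<in>insert t I. d s) = i"
      using I insert.hyps 2 by (subst sum.insert) (auto intro: finite_subset)
    moreover have "insert t I \<subseteq> insert t S" using I(1) by blast
    ultimately show ?thesis by blast
  qed
qed

lemma covering_function_mod:
  "covering_function S a n x = card {s \<in> S. x mod int (n s) = a s mod int (n s)}"
  by (simp add: covering_function_def residue_class_def)

theorem theorem1:
  fixes k m :: nat and a :: "nat \<Rightarrow> int" and n :: "nat \<Rightarrow> nat"
  assumes "k \<ge> 1" and "m \<ge> 1"
    and "\<And>s. s \<in> {1..k} \<Longrightarrow> n s > 0"
    and "is_m_cover_irredundant m {1..k} a n k"
    and "\<And>x. covering_function {1..k} a n (x + int (n k)) = covering_function {1..k} a n x"
  shows "\<forall>r \<in> {0..n k - 1}.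
    card {\<lfloor>\<Sum>s\<in>I. 1 / real (n s)\<rfloor> | I.
            I \<subseteq> {1..k - 1} \<and> frac (\<Sum>s\<in>I. 1 / real (n s)) = real r / real (n k)} \<ge> m"
proof
  fix r assume r: "r \<in> {0..n k - 1}"

  \<comment> \<open>The covering function without the irredundant class\<close>
  let ?w = "covering_function {1..k} a n"
  let ?w' = "covering_function {1..k - 1} a n"
  have nk: "n k > 0" using assms(1,3) by simp
  have w_eq: "?w x = ?w' x + (if x mod int (n k) = a k mod int (n k) then 1 else 0)" for x
  proof -
    have "{1..k} = insert k {1..k - 1}" using assms(1) by auto
    then have "{s \<in> {1..k}. x mod int (n s) = a s mod int (n s)}
      = (if x mod int (n k) = a k mod int (n k)
         then insert k {s \<in> {1..k - 1}. x mod int (n s) = a s mod int (n s)}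
         else {s \<in> {1..k - 1}. x mod int (n s) = a s mod int (n s)})"
      by auto
    moreover have "k \<notin> {1..k - 1}" using assms(1) by auto
    ultimately show ?thesis by (simp add: covering_function_mod)
  qed
  have "{1..k} - {k} = {1..k - 1}" using assms(1) by auto
  then obtain x0 where x0: "?w' x0 < m" and w_ge: "?w x \<ge> m" for x
    using assms(4) by (auto simp: is_m_cover_irredundant_def is_m_cover_def not_le)
  have w_shift: "?w (x + int (n k) * int i) = ?w x" for x i
  proof (induction i)
    case (Suc i)
    then show ?case
      using assms(5)[of "x + int (n k) * int i"] by (simp add: algebra_simps)
  qed simp
  have w_cong: "?w x = ?w y" if "x mod int (n k) = y mod int (n k)" for x y
  proof -
    \<comment> \<open>\<open>w_shift\<close> only moves upwards: from the residue to
      \<open>x\<close> if \<open>x\<close> is nonnegative, and from \<open>x\<close> to the residue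
      otherwise.\<close>
    have *: "?w x = ?w (x mod int (n k))" for x
    proof (cases "x \<ge> 0")
      case True
      then show ?thesis
        using w_shift[of "x mod int (n k)" "nat (x div int (n k))"]
        by (simp add: pos_imp_zdiv_nonneg_iff nk)
    next
      case False
      then have "x div int (n k) \<le> 0"
        using nk by (simp add: div_nonpos_pos_le0)
      then have "x + int (n k) * int (nat (- (x div int (n k)))) = x mod int (n k)"
        by (simp add: minus_mult_div_eq_mod)
      then show ?thesis
        using w_shift[of x "nat (- (x div int (n k)))"] by metis
    qed
    show ?thesis using *[of x] *[of y] that by simp
  qed
  have w'_cong: "?w' x = ?w' y" if "x mod int (n k) = y mod int (n k)" for x y
    using w_cong[OF that] w_eq[of x] w_eq[of y] that by simp
  have x0_class: "x0 mod int (n k) = a k mod int (n k)"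
    using x0 w_ge[of x0] w_eq[of x0] by (auto split: if_splits)
  \<comment> \<open>The truncated subtraction is harmless, since \<open>?w' x\<close> is at least
    \<open>m - 1\<close> everywhere.\<close>
  define v where "v x = ?w' x - (m - 1)" for x
  have w'_v: "?w' x = (m - 1) + v x" for x
    using w_ge[of x] w_eq[of x] by (auto simp: v_def split: if_splits)
  \<comment> \<open>On the class \<open>?w'\<close> takes the value \<open>?w' x0 < m\<close>
    throughout; off it \<open>?w'\<close> agrees with \<open>?w\<close>, which is at least
    \<open>m\<close>.\<close>
  have v_0_iff: "v x = 0 \<longleftrightarrow> x mod int (n k) = a k mod int (n k)" for x
  proof
    assume "x mod int (n k) = a k mod int (n k)"
    then show "v x = 0"
      using w'_cong[of x x0] x0 x0_class by (simp add: v_def)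
  qed (use w_ge[of x] w_eq[of x] assms(2) in \<open>auto simp: v_def split: if_splits\<close>)
  have v_cong: "v x = v y" if "x mod int (n k) = y mod int (n k)" for x y
    using w'_cong[OF that] by (simp add: v_def)

  \<comment> \<open>The polynomial \<open>P\<close> and its cofactor \<open>T\<close>\<close>
  define N where "N = (\<Prod>s\<in>{1..k}. n s)"
  define d where "d s = N div n s" for s
  have N: "N > 0" using assms(3) by (auto simp: N_def intro!: prod_pos)
  have nd: "n s * d s = N" if "s \<in> {1..k}" for s
    unfolding d_def N_def using that by (intro dvd_mult_div_cancel dvd_prodI) auto
  have d: "d s > 0" if "s \<in> {1..k}" for s
    using nd[OF that] N by (metis gr0I mult_0_right)
  have k: "k \<in> {1..k}" using assms(1) by simp
  have nk_dvd: "int (n k) dvd int N"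
    using nd[OF k] by (metis dvd_triv_left of_nat_dvd_iff)

  define L where "L x = 1 - monom (unity_root N (- x)) 1" for x
  define P where "P = (\<Prod>s\<in>{1..k - 1}. 1 - monom (unity_root (n s) (- a s)) (d s))"
  define T where "T = (\<Prod>x\<in>{0..<int N}. L x ^ v x)"
  have "P = (\<Prod>s\<in>{1..k - 1}. \<Prod>x\<in>{x \<in> {0..<int N}. x mod int (n s) = a s mod int (n s)}. L x)"
    unfolding P_def
  proof (rule prod.cong[OF refl])
    fix s assume "s \<in> {1..k - 1}"
    then have s: "s \<in> {1..k}" by auto
    show "1 - monom (unity_root (n s) (- a s)) (d s)
        = (\<Prod>x\<in>{x \<in> {0..<int N}. x mod int (n s) = a s mod int (n s)}. L x)"
      using one_minus_monom_eq_prod[OF assms(3)[OF s] d[OF s], of "a s"]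
      unfolding nd[OF s] L_def .
  qed
  \<comment> \<open>Double counting: \<open>L x\<close> occurs once for each of the first
    \<open>k - 1\<close> classes containing \<open>x\<close>.\<close>
  also have "\<dots> = (\<Prod>x\<in>{0..<int N}. \<Prod>s\<in>{s \<in> {1..k - 1}. x mod int (n s) = a s mod int (n s)}. L x)"
    by (rule prod.swap_restrict) auto
  also have "\<dots> = (\<Prod>x\<in>{0..<int N}. L x ^ ?w' x)"
    by (simp add: covering_function_mod)
  also have "\<dots> = (\<Prod>x\<in>{0..<int N}. L x) ^ (m - 1) * T"
    unfolding w'_v power_add prod.distrib prod_power_distrib T_def ..
  \<comment> \<open>With modulus 1 the residue class is all of the integers.\<close>
  also have "(\<Prod>x\<in>{0..<int N}. L x) = 1 - monom 1 N"
    using one_minus_monom_eq_prod[of 1 N 0] N by (simp add: L_def atLeastLessThan_def lessThan_def atLeast_def Collect_conj_eq)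
  finally have P_eq: "P = (1 - monom 1 N) ^ (m - 1) * T" .

  have poly_T: "poly T (unity_root N y) = (\<Prod>x\<in>{0..<int N}. (1 - unity_root N (y - x)) ^ v x)" for y
    by (simp add: T_def L_def poly_prod poly_monom unity_root_mult)
  \<comment> \<open>Translation by \<open>c\<close> permutes the residues modulo \<open>N\<close>
    and preserves \<open>v\<close>, because \<open>n k\<close> divides both \<open>N\<close> and
    \<open>c\<close>.\<close>
  have poly_T_shift: "poly T (unity_root N (y + c)) = poly T (unity_root N y)"
    if c: "int (n k) dvd c" for y c
  proof -
    have "poly T (unity_root N (y + c))
        = (\<Prod>x\<in>{0..<int N}. (1 - unity_root N (y + c - (x + c) mod int N)) ^ v ((x + c) mod int N))"
      unfolding poly_T by (rule prod.reindex_bij_betw[OF bij_betw_shift_mod[OF N], symmetric])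
    also have "\<dots> = (\<Prod>x\<in>{0..<int N}. (1 - unity_root N (y - x)) ^ v x)"
    proof (rule prod.cong[OF refl])
      fix x
      have "unity_root N (y + c - (x + c) mod int N) = unity_root N (y - x)"
      proof (rule unity_root_cong[OF N])
        have "(y + c - (x + c) mod int N) mod int N = (y - x) mod int N"
          by (simp add: mod_simps)
        then show "int N dvd (y + c - (x + c) mod int N) - (y - x)"
          by (simp only: mod_eq_dvd_iff)
      qed
      moreover have "v ((x + c) mod int N) = v x"
      proof (rule v_cong)
        have "(x + c) mod int N mod int (n k) = (x + c) mod int (n k)"
          using nk_dvd by (rule mod_mod_cancel)
        also have "\<dots> = x mod int (n k)"
          using c by (simp add: mod_eq_dvd_iff)
        finally show "(x + c) mod int N mod int (n k) = x mod int (n k)" .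
      qed
      ultimately show "(1 - unity_root N (y + c - (x + c) mod int N)) ^ v ((x + c) mod int N)
          = (1 - unity_root N (y - x)) ^ v x" by simp
    qed
    finally show ?thesis by (simp add: poly_T)
  qed
  have poly_T_0: "poly T (unity_root N y) = 0"
    if "y \<in> {0..<int N}" "y mod int (n k) \<noteq> a k mod int (n k)" for y
    unfolding poly_T using that v_0_iff[of y] by (intro prod_zero) (auto intro!: bexI[of _ y])
  have poly_T_class: "poly T (unity_root N y) = poly T (unity_root N (a k))"
    if "y mod int (n k) = a k mod int (n k)" for y
    using poly_T_shift[of "y - a k" "a k"] that by (simp add: mod_eq_dvd_iff)
  \<comment> \<open>A factor with zero base has \<open>x\<close> in the class of \<open>a k\<close>,
    where its exponent \<open>v x\<close> is 0.\<close>
  have poly_T_nz: "poly T (unity_root N (a k)) \<noteq> 0"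
  proof
    assume "poly T (unity_root N (a k)) = 0"
    then obtain x where "unity_root N (a k - x) = 1" "v x > 0"
      unfolding poly_T by (auto simp: prod_zero_iff)
    then have "int (n k) dvd a k - x"
      using nk_dvd N by (auto simp: unity_root_eq_1_iff intro: dvd_trans)
    then show False
      using v_0_iff[of x] \<open>v x > 0\<close> by (metis mod_eq_dvd_iff less_irrefl)
  qed

  \<comment> \<open>The section of \<open>P\<close> for the residue \<open>r\<close>\<close>
  define j where "j = r * d k"
  have "r < n k" using r nk by auto
  then have j: "j < N"
    using d[OF k] nd[OF k] by (auto simp: j_def)
  let ?C = "{y \<in> {0..<int N}. y mod int (n k) = a k mod int (n k)}"
  \<comment> \<open>As \<open>j\<close> is a multiple of \<open>d k\<close>, the weight in the
    filter depends only on \<open>y\<close> modulo \<open>n k\<close>, so all terms over the class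
    are equal and cannot cancel.\<close>
  have root_j: "unity_root N (- (y * int j)) = unity_root (n k) (- (a k * int r))"
    if "y mod int (n k) = a k mod int (n k)" for y
  proof -
    have "unity_root N (- (y * int j)) = unity_root (n k) (- (y * int r))"
      using unity_root_scale[OF d[OF k], of "n k" "- (y * int r)"] nd[OF k]
      by (simp add: j_def mult.assoc)
    also have "\<dots> = unity_root (n k) (- (a k * int r))"
    proof (rule unity_root_cong[OF nk])
      have "int (n k) dvd (a k - y) * int r"
        using that by (metis dvd_mult2 mod_eq_dvd_iff)
      then show "int (n k) dvd - (y * int r) - - (a k * int r)"
        by (simp add: algebra_simps)
    qed
    finally show ?thesis .
  qed
  have "of_nat N * poly (poly_section N j T) 1
      = (\<Sum>y\<in>{0..<int N}. unity_root N (- (y * int j)) * poly T (unity_root N y))"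
    by (rule poly_section_1_eq_sum[OF j])
  also have "\<dots> = (\<Sum>y\<in>?C. unity_root N (- (y * int j)) * poly T (unity_root N y))"
    using poly_T_0 by (intro sum.mono_neutral_right) auto
  also have "\<dots> = (\<Sum>y\<in>?C. unity_root (n k) (- (a k * int r)) * poly T (unity_root N (a k)))"
    by (intro sum.cong refl arg_cong2[of _ _ _ _ "(*)"] root_j poly_T_class) auto
  also have "\<dots> = of_nat (d k) * (unity_root (n k) (- (a k * int r)) * poly T (unity_root N (a k)))"
    using card_residues_lessThan[OF nk, of "d k" "a k"] by (simp add: nd[OF k])
  also have "\<dots> \<noteq> 0"
    using d[OF k] poly_T_nz by simp
  finally have "poly_section N j T \<noteq> 0" by auto
  moreover have section_P: "poly_section N j P = (1 - monom 1 1) ^ (m - 1) * poly_section N j T"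
    unfolding P_eq by (rule poly_section_one_minus_X_power_mult[OF j])
  moreover have "(1 - monom 1 1 :: complex poly) \<noteq> 0"
  proof
    assume "(1 - monom 1 1 :: complex poly) = 0"
    then have "poly (1 - monom 1 1 :: complex poly) 0 = 0" by (metis poly_0)
    then show False by (simp add: poly_monom)
  qed
  ultimately have "Suc (m - 1) \<le> card {q. coeff (poly_section N j P) q \<noteq> 0}"
    by (intro Suc_le_card_coeffs_if_dvd) auto
  then have "m \<le> card {q. coeff P (j + N * q) \<noteq> 0}"
    using assms(2) by (simp add: coeff_poly_section[OF N])
  also have "\<dots> = card (int ` {q. coeff P (j + N * q) \<noteq> 0})"
    by (simp add: card_image)
  also have "\<dots> \<le> card {\<lfloor>\<Sum>s\<in>I. 1 / real (n s)\<rfloor> | I.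
            I \<subseteq> {1..k - 1} \<and> frac (\<Sum>s\<in>I. 1 / real (n s)) = real r / real (n k)}"
    (is "_ \<le> card ?F")
  proof (rule card_mono)
    have "?F \<subseteq> (\<lambda>I. \<lfloor>\<Sum>s\<in>I. 1 / real (n s)\<rfloor>) ` Pow {1..k - 1}" by auto
    then show "finite ?F" by (rule finite_subset) simp
    show "int ` {q. coeff P (j + N * q) \<noteq> 0} \<subseteq> ?F"
    proof
      fix z assume "z \<in> int ` {q. coeff P (j + N * q) \<noteq> 0}"
      then obtain q where z: "z = int q" and q: "coeff P (j + N * q) \<noteq> 0" by auto
      obtain I where I: "I \<subseteq> {1..k - 1}" "(\<Sum>s\<in>I. d s) = j + N * q"
        using coeff_prod_one_minus_monom_nonzero[OF finite_atLeastAtMost q[unfolded P_def]] by auto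
      have inv: "1 / real (n s) = real (d s) / real N" if "s \<in> {1..k}" for s
        using d[OF that] unfolding nd[OF that, symmetric] by simp
      have "I \<subseteq> {1..k}"
        using I(1) by (rule order.trans) auto
      then have "(\<Sum>s\<in>I. 1 / real (n s)) = (\<Sum>s\<in>I. real (d s) / real N)"
        by (intro sum.cong refl inv) auto
      also have "\<dots> = real (j + N * q) / real N"
        by (simp add: I(2)[symmetric] sum_divide_distrib)
      \<comment> \<open>Here the choice \<open>j = r * d k\<close> pays off: \<open>j / N\<close> is
        the prescribed fractional part and \<open>q\<close> the integral part.\<close>
      also have "\<dots> = real r * (real (d k) / real N) + real q"
        using N by (simp add: j_def field_simps)
      also have "\<dots> = real r / real (n k) + real q"
        by (simp flip: inv[OF k])
      finally have sum_I: "(\<Sum>s\<in>I. 1 / real (n s)) = real r / real (n k) + real q" .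
      have bounds: "0 \<le> real r / real (n k)" "real r / real (n k) < 1"
        using \<open>r < n k\<close> by auto
      then have "\<lfloor>\<Sum>s\<in>I. 1 / real (n s)\<rfloor> = int q"
        unfolding sum_I by (intro floor_unique) auto
      moreover from this have "frac (\<Sum>s\<in>I. 1 / real (n s)) = real r / real (n k)"
        by (simp add: frac_def sum_I)
      ultimately show "z \<in> ?F"
        using I(1) z by (intro CollectI exI[of _ I]) auto
    qed
  qed
  finally show "m \<le> card ?F" .
qed

end
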